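(* Let $D=(d_{ij})$ be an $n\times n$ Euclidean distance matrix of embedding dimension $r=n-2$. Then $D$ is in general position in $\mathbb{R}^r$ if and only if every off-diagonal entry of $D$ is yielding.
   Context: An $n\times n$ real matrix $D=(d_{ij})$ is a Euclidean distance matrix (EDM) if there exist points $p^1,\ldots,p^n$ in some Euclidean space with $d_{ij}=\|p^i-p^j\|^2$ for all $i,j$; such points are generating points of $D$, and the dimension of their affine span is the embedding dimension $r$ of $D$ (the generating points can be taken in $\mathbb{R}^r$). For $i\ne j$, $E^{ij}$ is the $n\times n$ symmetric matrix with 1's in the $ij$th and $ji$th entries and 0's elsewhere. For an off-diagonal entry $d_{ij}$, the set of real $t$ such that $D+tE^{ij}$ is an EDM is a closed interval $[l_{ij},u_{ij}]$ with $l_{ij}\le 0\le u_{ij}$ (with $u_{ij}=+\infty$ when $n=2$). The entry $d_{ij}$ is unyielding if $l_{ij}=u_{ij}=0$, and yielding if $l_{ij}\ne u_{ij}$. Points $p^1,\ldots,p^n$ in $\mathbb{R}^r$ are in general position if every $r+1$ of them are affinely independent (as an indexed family). An EDM of embedding dimension $r$ is in general position if its generating points in $\mathbb{R}^r$ are in general position. *)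

theory Defs
  imports "HOL-Analysis.Analysis"
begin

definition generates :: "('n::finite \<Rightarrow> 'a::euclidean_space) \<Rightarrow> real^'n^'n \<Rightarrow> bool" where
  "generates p D \<longleftrightarrow> (\<forall>i j. D $ i $ j = (norm (p i - p j))\<^sup>2)"

text \<open>HOL cannot quantify existentially over the type of the ambient Euclidean space, so the
  definitions below take the generating points in \<open>real^'n\<close>. The lemmas
  \<open>generates_imp_is_EDM\<close>, \<open>embedding_dim_eq\<close> and \<open>EDM_general_position_iff\<close> show that any
  Euclidean space and any family of generating points may be used instead.\<close>

definition is_EDM :: "real^'n^'n \<Rightarrow> bool" where
  "is_EDM D \<longleftrightarrow> (\<exists>p :: 'n::finite \<Rightarrow> real^'n. generates p D)"

definition embedding_dim :: "real^'n^'n \<Rightarrow> int" where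
  "embedding_dim D = aff_dim (range (SOME p :: 'n::finite \<Rightarrow> real^'n. generates p D))"

definition affinely_independent_family :: "('n \<Rightarrow> 'a::real_vector) \<Rightarrow> 'n set \<Rightarrow> bool" where
  "affinely_independent_family p S \<longleftrightarrow> inj_on p S \<and> \<not> affine_dependent (p ` S)"

definition points_general_position :: "int \<Rightarrow> ('n::finite \<Rightarrow> 'a::real_vector) \<Rightarrow> bool" where
  "points_general_position r p \<longleftrightarrow>
     (\<forall>S. int (card S) = r + 1 \<longrightarrow> affinely_independent_family p S)"

text \<open>With \<open>r = embedding_dim D\<close>, all generating points lie in an affine space of dimension \<open>r\<close>,
  a copy of \<open>\<real>\<^sup>r\<close>. Affine independence does not depend on the space around it, and \<open>r = 0\<close> is
  included, although no type has Euclidean dimension 0.\<close>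

definition EDM_general_position :: "real^'n^'n \<Rightarrow> bool" where
  "EDM_general_position D \<longleftrightarrow>
     (\<forall>p :: 'n::finite \<Rightarrow> real^'n. generates p D \<longrightarrow> points_general_position (embedding_dim D) p)"

definition E_mat :: "'n::finite \<Rightarrow> 'n \<Rightarrow> real^'n^'n" where
  "E_mat i j = (\<chi> k l. if (k = i \<and> l = j) \<or> (k = j \<and> l = i) then 1 else 0)"

definition EDM_shifts :: "real^'n^'n \<Rightarrow> 'n::finite \<Rightarrow> 'n \<Rightarrow> real set" where
  "EDM_shifts D i j = {t. is_EDM (D + t *\<^sub>R E_mat i j)}"

text \<open>The endpoints of the interval of admissible shifts, as extended reals because the upper
  endpoint is infinite when the matrix is \<open>2 \<times> 2\<close>.\<close>

definition lower_shift :: "real^'n^'n \<Rightarrow> 'n::finite \<Rightarrow> 'n \<Rightarrow> ereal" where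
  "lower_shift D i j = (INF t \<in> EDM_shifts D i j. ereal t)"

definition upper_shift :: "real^'n^'n \<Rightarrow> 'n::finite \<Rightarrow> 'n \<Rightarrow> ereal" where
  "upper_shift D i j = (SUP t \<in> EDM_shifts D i j. ereal t)"

definition yielding :: "real^'n^'n \<Rightarrow> 'n::finite \<Rightarrow> 'n \<Rightarrow> bool" where
  "yielding D i j \<longleftrightarrow> lower_shift D i j \<noteq> upper_shift D i j"


subsection \<open>Independence of the ambient space and of the generating points\<close>

lemma generates_imp_is_EDM:
  fixes p :: "'n::finite \<Rightarrow> 'a::euclidean_space"
  assumes "generates p D"
  shows "is_EDM D"
proof -
  obtain a :: 'n where True by simp
  define B where "B = (\<lambda>i. p i - p a) ` (UNIV - {a})"
  have "dim (span B) \<le> card B"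
    by (simp add: B_def dim_le_card')
  also have "\<dots> \<le> card (UNIV - {a})"
    unfolding B_def by (rule card_image_le) simp
  also have "\<dots> \<le> CARD('n)" by (simp add: card_mono)
  finally have "dim (span B) \<le> dim (UNIV :: (real^'n) set)" by simp
  then obtain f :: "'a \<Rightarrow> real^'n"
    where f: "linear f" "\<And>x. x \<in> span B \<Longrightarrow> norm (f x) = norm x"
    using isometry_subset_subspace[of "span B" "UNIV :: (real^'n) set"] by auto
  have inB: "p i - p a \<in> span B" for i
    by (cases "i = a") (auto simp: B_def span_zero intro: span_base)
  have "norm (f (p i - p a) - f (p j - p a)) = norm (p i - p j)" for i j
  proof -
    have "f (p i - p a) - f (p j - p a) = f (p i - p j)"
      using linear_diff[OF f(1), of "p i - p a" "p j - p a"] by simp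
    moreover have "p i - p j \<in> span B"
      using span_diff[OF inB[of i] inB[of j]] by simp
    ultimately show ?thesis using f(2) by simp
  qed
  then have "generates (\<lambda>i. f (p i - p a)) D"
    using assms by (simp add: generates_def)
  then show ?thesis unfolding is_EDM_def by blast
qed

lemma affinely_independent_family_iff:
  fixes p :: "'n::finite \<Rightarrow> 'a::real_vector"
  shows "affinely_independent_family p S \<longleftrightarrow>
    (\<forall>c. sum c S = 0 \<and> (\<Sum>i\<in>S. c i *\<^sub>R p i) = 0 \<longrightarrow> (\<forall>i\<in>S. c i = 0))" (is "_ \<longleftrightarrow> ?R")
proof
  assume *: "affinely_independent_family p S"
  then have inj: "inj_on p S" by (simp add: affinely_independent_family_def)
  show ?R
  proof (intro allI impI, elim conjE)
    fix c assume c: "sum c S = 0" "(\<Sum>i\<in>S. c i *\<^sub>R p i) = 0"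
    define U where "U = c \<circ> inv_into S p"
    have U: "U (p i) = c i" if "i \<in> S" for i using that inj by (simp add: U_def)
    have "sum U (p ` S) = 0" "(\<Sum>v\<in>p ` S. U v *\<^sub>R v) = 0"
      using c U by (simp_all add: sum.reindex[OF inj])
    then have "\<forall>v\<in>p ` S. U v = 0"
      using * unfolding affinely_independent_family_def
      using affine_dependent_explicit_finite[of "p ` S"] by auto
    then show "\<forall>i\<in>S. c i = 0" using U by auto
  qed
next
  assume R: ?R
  have inj: "inj_on p S"
  proof (rule inj_onI, rule ccontr)
    fix x y assume xy: "x \<in> S" "y \<in> S" "p x = p y" "x \<noteq> y"
    define c :: "'n \<Rightarrow> real" where "c = (\<lambda>i. (if i = x then 1 else 0) - (if i = y then 1 else 0))"
    have "sum c S = 0"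
      using xy by (simp add: c_def sum_subtractf)
    moreover have "(\<Sum>i\<in>S. c i *\<^sub>R p i) = 0"
      using xy by (simp add: c_def scaleR_left_diff_distrib sum_subtractf if_distrib[of "\<lambda>t. t *\<^sub>R _"]
          cong: if_cong)
    ultimately have "c x = 0" using R xy by blast
    then show False using xy by (simp add: c_def)
  qed
  moreover have "\<not> affine_dependent (p ` S)"
  proof
    assume "affine_dependent (p ` S)"
    then obtain U where U: "sum U (p ` S) = 0" "\<exists>v\<in>p ` S. U v \<noteq> 0" "(\<Sum>v\<in>p ` S. U v *\<^sub>R v) = 0"
      using affine_dependent_explicit_finite[of "p ` S"] by auto
    then have "sum (U \<circ> p) S = 0" "(\<Sum>i\<in>S. (U \<circ> p) i *\<^sub>R p i) = 0"
      by (simp_all add: sum.reindex[OF inj])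
    then have "\<forall>i\<in>S. (U \<circ> p) i = 0" using R by blast
    then show False using U(2) by auto
  qed
  ultimately show "affinely_independent_family p S"
    by (simp add: affinely_independent_family_def)
qed

lemma generates_norm_comb:
  fixes p :: "'n::finite \<Rightarrow> 'a::euclidean_space"
  assumes "generates p D" "sum c S = 0"
  shows "(norm (\<Sum>i\<in>S. c i *\<^sub>R p i))\<^sup>2 = - (\<Sum>i\<in>S. \<Sum>j\<in>S. c i * c j * D $ i $ j) / 2"
proof -
  have D: "D $ i $ j = p i \<bullet> p i + p j \<bullet> p j - 2 * (p i \<bullet> p j)" for i j
    using assms(1) by (simp add: generates_def power2_norm_eq_inner inner_diff inner_commute)
  have "(\<Sum>i\<in>S. \<Sum>j\<in>S. c i * c j * D $ i $ j) =
      (\<Sum>i\<in>S. \<Sum>j\<in>S. (c i * (p i \<bullet> p i)) * c j + c i * (c j * (p j \<bullet> p j)) - 2 * (c i * c j * (p i \<bullet> p j)))"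
    by (intro sum.cong refl) (simp add: D algebra_simps)
  also have "\<dots> = (\<Sum>i\<in>S. c i * (p i \<bullet> p i)) * sum c S + sum c S * (\<Sum>j\<in>S. c j * (p j \<bullet> p j))
      - 2 * (\<Sum>i\<in>S. \<Sum>j\<in>S. c i * c j * (p i \<bullet> p j))"
    by (simp only: sum.distrib sum_subtractf sum_product sum_distrib_left[of 2])
  also have "\<dots> = - 2 * (\<Sum>i\<in>S. \<Sum>j\<in>S. c i * c j * (p i \<bullet> p j))"
    by (simp add: assms(2))
  also have "(\<Sum>i\<in>S. \<Sum>j\<in>S. c i * c j * (p i \<bullet> p j)) = (norm (\<Sum>i\<in>S. c i *\<^sub>R p i))\<^sup>2"
    unfolding power2_norm_eq_inner inner_sum_left
    by (intro sum.cong refl) (simp add: inner_sum_right sum_distrib_left mult_ac)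
  finally show ?thesis by simp
qed

lemma generates_affinely_independent_cong:
  fixes p :: "'n::finite \<Rightarrow> 'a::euclidean_space" and q :: "'n \<Rightarrow> 'b::euclidean_space"
  assumes "generates p D" "generates q D"
  shows "affinely_independent_family p S \<longleftrightarrow> affinely_independent_family q S"
proof -
  have "(\<Sum>i\<in>S. c i *\<^sub>R p i) = 0 \<longleftrightarrow> (\<Sum>i\<in>S. c i *\<^sub>R q i) = 0" if "sum c S = 0" for c
  proof -
    have "(norm (\<Sum>i\<in>S. c i *\<^sub>R p i))\<^sup>2 = (norm (\<Sum>i\<in>S. c i *\<^sub>R q i))\<^sup>2"
      by (simp only: generates_norm_comb[OF assms(1) that] generates_norm_comb[OF assms(2) that])
    then have "norm (\<Sum>i\<in>S. c i *\<^sub>R p i) = norm (\<Sum>i\<in>S. c i *\<^sub>R q i)"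
      by (rule power2_eq_imp_eq) simp_all
    then show ?thesis by (metis norm_eq_zero)
  qed
  then show ?thesis unfolding affinely_independent_family_iff by blast
qed

lemma generates_aff_dim_le:
  fixes p :: "'n::finite \<Rightarrow> 'a::euclidean_space" and q :: "'n \<Rightarrow> 'b::euclidean_space"
  assumes "generates p D" "generates q D"
  shows "aff_dim (range p) \<le> aff_dim (range q)"
proof -
  obtain B where B: "B \<subseteq> range p" "\<not> affine_dependent B" "affine hull (range p) = affine hull B"
    using affine_basis_exists[of "range p"] by blast
  obtain J where J: "B = p ` J" "inj_on p J"
    using B(1) by (meson subset_image_inj)
  have "aff_dim (range p) = int (card J) - 1"
    using aff_dim_unique[of B "range p"] B J by (simp add: card_image)
  moreover have "affinely_independent_family q J"
    using B J generates_affinely_independent_cong[OF assms, of J]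
    by (simp add: affinely_independent_family_def)
  then have "aff_dim (q ` J) = int (card J) - 1"
    by (simp add: affinely_independent_family_def affine_independent_iff_card card_image)
  moreover have "aff_dim (q ` J) \<le> aff_dim (range q)"
    by (rule aff_dim_subset) auto
  ultimately show ?thesis by simp
qed

lemma generates_aff_dim_eq:
  fixes p :: "'n::finite \<Rightarrow> 'a::euclidean_space" and q :: "'n \<Rightarrow> 'b::euclidean_space"
  assumes "generates p D" "generates q D"
  shows "aff_dim (range p) = aff_dim (range q)"
  using generates_aff_dim_le[OF assms] generates_aff_dim_le[OF assms(2,1)] by simp

lemma embedding_dim_eq:
  fixes p :: "'n::finite \<Rightarrow> 'a::euclidean_space"
  assumes "generates p D"
  shows "embedding_dim D = aff_dim (range p)"
proof -
  have "\<exists>q :: 'n \<Rightarrow> real^'n. generates q D"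
    using generates_imp_is_EDM[OF assms] by (simp add: is_EDM_def)
  then have "generates (SOME q :: 'n \<Rightarrow> real^'n. generates q D) D"
    by (rule someI_ex)
  from generates_aff_dim_eq[OF this assms] show ?thesis
    by (simp add: embedding_dim_def)
qed

lemma EDM_general_position_iff:
  fixes p :: "'n::finite \<Rightarrow> 'a::euclidean_space"
  assumes "generates p D"
  shows "EDM_general_position D \<longleftrightarrow> points_general_position (embedding_dim D) p"
proof -
  obtain q :: "'n \<Rightarrow> real^'n" where q: "generates q D"
    using generates_imp_is_EDM[OF assms] by (auto simp: is_EDM_def)
  have "points_general_position (embedding_dim D) q' \<longleftrightarrow> points_general_position (embedding_dim D) p"
    if "generates q' D" for q' :: "'n \<Rightarrow> real^'n"
    using generates_affinely_independent_cong[OF that assms]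
    by (simp add: points_general_position_def)
  then show ?thesis using q unfolding EDM_general_position_def by blast
qed

end

theory Submission
  imports Defs
begin

text \<open>Let \<open>p\<close> generate \<open>D\<close>. Since the \<open>n\<close> points span only dimension \<open>n - 2\<close>, they satisfy
  some affine dependency \<open>\<Sum>i. c i *\<^sub>R p i = 0\<close>, \<open>\<Sum>i. c i = 0\<close> with \<open>c \<noteq> 0\<close>, and general
  position, which concerns the subfamilies of \<open>n - 1\<close> points, says precisely that no such
  dependency has a zero coefficient
  (\<open>points_general_position_iff_dependencies_nowhere_zero\<close>).

  If \<open>c\<close> is nowhere zero, take a hyperplane \<open>u \<bullet> x = b\<close> through all points except \<open>p i\<close> and
  \<open>p j\<close> that misses \<open>p i\<close>. Applying \<open>u \<bullet> x - b\<close> to the dependency leaves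
  \<open>c i * (u \<bullet> p i - b) + c j * (u \<bullet> p j - b) = 0\<close>, so the hyperplane misses \<open>p j\<close> as well.
  Reflecting \<open>p i\<close> in it preserves the distances to all points except \<open>p j\<close> and changes the
  distance to \<open>p j\<close>, so \<open>D + t *\<^sub>R E_mat i j\<close> is an EDM for some \<open>t \<noteq> 0\<close>
  (\<open>nonzero_shift_by_reflection\<close>).

  Conversely, an EDM gives a form that is nonpositive on the vectors with coordinate sum zero.
  If \<open>c i = 0 \<noteq> c j\<close>, evaluate the form of \<open>D + t *\<^sub>R E_mat i j\<close> at the \<open>i\<close>-th minus the
  \<open>j\<close>-th unit vector plus a multiple \<open>s\<close> of \<open>c\<close>. The contribution of \<open>D\<close> does not depend on
  \<open>s\<close>, while that of \<open>t\<close> is affine in \<open>s\<close> with slope proportional to \<open>t * c j\<close>. Boundedness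
  from one side forces \<open>t = 0\<close> (\<open>shift_eq_0_if_dependency_vanishes_at_one_end\<close>).\<close>


section \<open>Hyperplanes and reflections\<close>

text \<open>The component of \<open>a - f\<close> orthogonal to the directions of the hull, for a base point
  \<open>f \<in> F\<close>, is a normal of such a hyperplane.\<close>

lemma hyperplane_through_set_missing_point:
  fixes a :: "'a::euclidean_space"
  assumes "a \<notin> affine hull F"
  obtains u b where "u \<noteq> 0" "\<And>x. x \<in> F \<Longrightarrow> u \<bullet> x = b" "u \<bullet> a \<noteq> b"
proof (cases "F = {}")
  case True
  \<comment> \<open>This case occurs in the theorem for \<open>n = 2\<close>, where no points besides \<open>p i\<close> and \<open>p j\<close> remain.\<close>
  obtain u :: 'a where "u \<noteq> 0"
    using nonempty_Basis nonzero_Basis by blast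
  then show ?thesis
    using that[of u "u \<bullet> a - 1"] True by simp
next
  case False
  then obtain f where f: "f \<in> F" by blast
  define T where "T = (\<lambda>x. - f + x) ` (F - {f})"
  obtain y z where yz: "y \<in> span T" "\<And>w. w \<in> span T \<Longrightarrow> orthogonal z w" "a - f = y + z"
    using orthogonal_subspace_decomp_exists[of T "a - f"] by metis
  have "a - f \<notin> span T"
  proof
    assume "a - f \<in> span T"
    then have "f + (a - f) \<in> affine hull F"
      unfolding affine_hull_span2[OF f] T_def by blast
    then show False using assms by simp
  qed
  then have "z \<noteq> 0" using yz(1,3) by auto
  have zF: "z \<bullet> x = z \<bullet> f" if "x \<in> F" for x
  proof (cases "x = f")
    case False
    then have "- f + x \<in> span T" using that by (auto simp: T_def intro: span_base)
    then show ?thesis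
      using yz(2)[of "- f + x"] by (simp add: orthogonal_def inner_diff_right)
  qed simp
  have "z \<bullet> (a - f) = z \<bullet> z"
    using yz(2)[OF yz(1)] by (simp add: yz(3) orthogonal_def inner_add_right)
  then have "z \<bullet> a \<noteq> z \<bullet> f"
    using \<open>z \<noteq> 0\<close> by (metis eq_iff_diff_eq_0 inner_diff_right inner_eq_zero_iff)
  with \<open>z \<noteq> 0\<close> zF that show ?thesis by blast
qed

lemma dist_reflection_in_hyperplane:
  fixes u x y :: "'a::real_inner"
  assumes "u \<noteq> 0"
  shows "(norm (x - (2 * (u \<bullet> x - b) / (u \<bullet> u)) *\<^sub>R u - y))\<^sup>2
    = (norm (x - y))\<^sup>2 + 4 * (u \<bullet> x - b) * (u \<bullet> y - b) / (u \<bullet> u)"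
proof -
  define s where "s = 2 * (u \<bullet> x - b) / (u \<bullet> u)"
  have s: "s * (u \<bullet> u) = 2 * (u \<bullet> x - b)"
    using assms by (simp add: s_def)
  have "(norm (x - s *\<^sub>R u - y))\<^sup>2 = (norm (x - y))\<^sup>2 - 2 * s * (u \<bullet> x - u \<bullet> y) + s * (s * (u \<bullet> u))"
    by (simp add: power2_norm_eq_inner inner_diff inner_commute algebra_simps)
  also have "\<dots> = (norm (x - y))\<^sup>2 + 2 * s * (u \<bullet> y - b)"
    unfolding s by (simp add: algebra_simps)
  also have "2 * s * (u \<bullet> y - b) = 4 * (u \<bullet> x - b) * (u \<bullet> y - b) / (u \<bullet> u)"
    by (simp add: s_def)
  finally show ?thesis by (simp add: s_def)
qed

section \<open>General position and affine dependencies\<close>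

text \<open>A dependency with a zero coefficient at \<open>i\<close> is the same thing as a dependency among the
  points other than \<open>p i\<close>.\<close>

lemma points_general_position_iff_dependencies_nowhere_zero:
  fixes p :: "'n::finite \<Rightarrow> 'a::real_vector"
  shows "points_general_position (int CARD('n) - 2) p \<longleftrightarrow>
    (\<forall>c. sum c UNIV = 0 \<longrightarrow> (\<Sum>i\<in>UNIV. c i *\<^sub>R p i) = 0 \<longrightarrow> c \<noteq> (\<lambda>_. 0) \<longrightarrow> (\<forall>i. c i \<noteq> 0))"
    (is "_ \<longleftrightarrow> ?R")
proof
  assume gp: "points_general_position (int CARD('n) - 2) p"
  show ?R
  proof (intro allI impI notI)
    fix c i
    assume c: "sum c UNIV = 0" "(\<Sum>i\<in>UNIV. c i *\<^sub>R p i) = 0" "c \<noteq> (\<lambda>_. 0)" and "c i = 0"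
    have "affinely_independent_family p (UNIV - {i})"
      using gp by (simp add: points_general_position_def card_Diff_singleton of_nat_diff Suc_leI)
    moreover have "sum c (UNIV - {i}) = 0" "(\<Sum>k\<in>UNIV - {i}. c k *\<^sub>R p k) = 0"
      using c \<open>c i = 0\<close> sum.remove[of UNIV i c] sum.remove[of UNIV i "\<lambda>k. c k *\<^sub>R p k"]
      by simp_all
    ultimately have "\<forall>k\<in>UNIV - {i}. c k = 0"
      unfolding affinely_independent_family_iff by blast
    with \<open>c i = 0\<close> c(3) show False by auto
  qed
next
  assume R: ?R
  show "points_general_position (int CARD('n) - 2) p"
    unfolding points_general_position_def
  proof (intro allI impI)
    fix S :: "'n set"
    assume S: "int (card S) = int CARD('n) - 2 + 1"
    then have "S \<noteq> UNIV" by auto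
    then obtain i where i: "i \<notin> S" by blast
    show "affinely_independent_family p S"
      unfolding affinely_independent_family_iff
    proof (intro allI impI, elim conjE)
      fix c
      assume c: "sum c S = 0" "(\<Sum>k\<in>S. c k *\<^sub>R p k) = 0"
      define d where "d k = (if k \<in> S then c k else 0)" for k
      have "sum d UNIV = sum d S"
        by (rule sum.mono_neutral_right) (auto simp: d_def)
      moreover have "(\<Sum>k\<in>UNIV. d k *\<^sub>R p k) = (\<Sum>k\<in>S. d k *\<^sub>R p k)"
        by (rule sum.mono_neutral_right) (auto simp: d_def)
      ultimately have "sum d UNIV = 0" "(\<Sum>k\<in>UNIV. d k *\<^sub>R p k) = 0"
        using c by (simp_all add: d_def)
      moreover have "d i = 0" using i by (simp add: d_def)
      ultimately have "d = (\<lambda>_. 0)" using R by blast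
      then show "\<forall>k\<in>S. c k = 0" by (metis d_def)
    qed
  qed
qed

section \<open>Nonzero shifts\<close>

lemma zero_mem_EDM_shifts: "is_EDM D \<Longrightarrow> 0 \<in> EDM_shifts D i j"
  by (simp add: EDM_shifts_def)

lemma yielding_iff_nonzero_shift:
  assumes "is_EDM D"
  shows "yielding D i j \<longleftrightarrow> (\<exists>t \<in> EDM_shifts D i j. t \<noteq> 0)"
proof
  assume "yielding D i j"
  have "EDM_shifts D i j \<noteq> {0}"
  proof
    assume "EDM_shifts D i j = {0}"
    then have "lower_shift D i j = upper_shift D i j"
      by (simp add: lower_shift_def upper_shift_def)
    with \<open>yielding D i j\<close> show False by (simp add: yielding_def)
  qed
  then show "\<exists>t \<in> EDM_shifts D i j. t \<noteq> 0"
    using zero_mem_EDM_shifts[OF assms, of i j] by auto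
next
  assume "\<exists>t \<in> EDM_shifts D i j. t \<noteq> 0"
  then obtain t where t: "t \<in> EDM_shifts D i j" "t \<noteq> 0" by blast
  have bounds: "lower_shift D i j \<le> ereal s" "ereal s \<le> upper_shift D i j"
    if "s \<in> EDM_shifts D i j" for s
    unfolding lower_shift_def upper_shift_def using that by (rule INF_lower, rule SUP_upper)
  note bounds_0 = bounds[OF zero_mem_EDM_shifts[OF assms]]
  show "yielding D i j"
    unfolding yielding_def
  proof
    assume eq: "lower_shift D i j = upper_shift D i j"
    have "ereal t = ereal 0"
    proof (rule antisym)
      show "ereal t \<le> ereal 0"
        using bounds(2)[OF t(1)] bounds_0(1) unfolding eq by (rule order_trans)
      show "ereal 0 \<le> ereal t"
        using bounds_0(2) bounds(1)[OF t(1)] unfolding eq by (rule order_trans)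
    qed
    with t(2) show False by simp
  qed
qed

text \<open>Only the entries at \<open>(i, j)\<close> and \<open>(j, i)\<close> may change, so the moved point must keep its
  distance to every point but \<open>p j\<close>. The reflection does this because it fixes the hyperplane
  containing those points.\<close>

lemma nonzero_shift_by_reflection:
  fixes p :: "'n::finite \<Rightarrow> 'a::euclidean_space"
  assumes gen: "generates p D" and "i \<noteq> j"
    and c: "sum c UNIV = 0" "(\<Sum>k\<in>UNIV. c k *\<^sub>R p k) = 0" "c i \<noteq> 0"
    and off: "p i \<notin> affine hull (p ` (UNIV - {i, j}))"
  shows "\<exists>t \<in> EDM_shifts D i j. t \<noteq> 0"
proof -
  obtain u b where u: "u \<noteq> 0" "\<And>x. x \<in> p ` (UNIV - {i, j}) \<Longrightarrow> u \<bullet> x = b" "u \<bullet> p i \<noteq> b"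
    using hyperplane_through_set_missing_point[OF off] by blast
  then have on: "u \<bullet> p k = b" if "k \<noteq> i" "k \<noteq> j" for k using that by blast
  have "(\<Sum>k\<in>UNIV. c k * (u \<bullet> p k - b)) = u \<bullet> (\<Sum>k\<in>UNIV. c k *\<^sub>R p k) - sum c UNIV * b"
    by (simp add: inner_sum_right sum_distrib_right right_diff_distrib sum_subtractf)
  then have "(\<Sum>k\<in>UNIV. c k * (u \<bullet> p k - b)) = 0" using c by simp
  moreover have "(\<Sum>k\<in>UNIV. c k * (u \<bullet> p k - b)) = (\<Sum>k\<in>{i, j}. c k * (u \<bullet> p k - b))"
    by (rule sum.mono_neutral_right) (auto simp: on)
  ultimately have "c i * (u \<bullet> p i - b) + c j * (u \<bullet> p j - b) = 0"
    using \<open>i \<noteq> j\<close> by simp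
  with c(3) u(3) have "u \<bullet> p j \<noteq> b" by auto
  define t where "t = 4 * (u \<bullet> p i - b) * (u \<bullet> p j - b) / (u \<bullet> u)"
  have "t \<noteq> 0" using u \<open>u \<bullet> p j \<noteq> b\<close> by (simp add: t_def)
  define q where "q = p(i := p i - (2 * (u \<bullet> p i - b) / (u \<bullet> u)) *\<^sub>R u)"
  have "(norm (q i - p k))\<^sup>2 = D $ i $ k + 4 * (u \<bullet> p i - b) * (u \<bullet> p k - b) / (u \<bullet> u)" for k
    using dist_reflection_in_hyperplane[OF u(1)] gen by (simp add: q_def generates_def)
  then have qi: "(norm (q i - p k))\<^sup>2 = D $ i $ k + (if k = j then t else 0)" if "k \<noteq> i" for k
    using that on[of k] by (simp add: t_def)
  have D: "D $ k $ l = D $ l $ k" "D $ k $ k = 0" "(norm (p k - p l))\<^sup>2 = D $ k $ l" for k l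
    using gen by (simp_all add: generates_def norm_minus_commute)
  have q: "q k = p k" if "k \<noteq> i" for k using that by (simp add: q_def)
  have "(norm (q k - q l))\<^sup>2 = (D + t *\<^sub>R E_mat i j) $ k $ l" for k l
  proof (cases "k = i"; cases "l = i")
    assume "k = i" "l \<noteq> i"
    then show ?thesis using qi[of l] q[of l] \<open>i \<noteq> j\<close> by (simp add: E_mat_def)
  next
    assume "k \<noteq> i" "l = i"
    then show ?thesis
      using qi[of k] q[of k] \<open>i \<noteq> j\<close> D(1)[of k i]
      by (simp add: E_mat_def norm_minus_commute)
  next
    assume "k \<noteq> i" "l \<noteq> i"
    then show ?thesis using q D(3) by (simp add: E_mat_def)
  next
    assume "k = i" "l = i"
    then show ?thesis using \<open>i \<noteq> j\<close> D(2) by (simp add: E_mat_def)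
  qed
  then have "generates q (D + t *\<^sub>R E_mat i j)" by (simp add: generates_def)
  then have "t \<in> EDM_shifts D i j"
    by (simp add: EDM_shifts_def generates_imp_is_EDM)
  with \<open>t \<noteq> 0\<close> show ?thesis by blast
qed

section \<open>Unyielding entries\<close>

lemma E_mat_quadratic_form:
  fixes c :: "'n::finite \<Rightarrow> real"
  assumes "i \<noteq> j"
  shows "(\<Sum>k\<in>UNIV. \<Sum>l\<in>UNIV. c k * c l * E_mat i j $ k $ l) = 2 * c i * c j"
proof -
  have "c k * c l * E_mat i j $ k $ l =
      (if k = i then if l = j then c i * c j else 0 else 0)
      + (if k = j then if l = i then c i * c j else 0 else 0)" for k l
    using assms by (auto simp: E_mat_def)
  then have "(\<Sum>l\<in>UNIV. c k * c l * E_mat i j $ k $ l) =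
      (if k = i then c i * c j else 0) + (if k = j then c i * c j else 0)" for k
    by (simp add: sum.distrib)
  then show ?thesis by (simp add: sum.distrib)
qed

text \<open>The left side exceeds the right side by the squared norm of the same combination of points
  generating the shifted matrix.\<close>

lemma shift_bound:
  fixes p :: "'n::finite \<Rightarrow> 'a::euclidean_space"
  assumes gen: "generates p D" and "i \<noteq> j" and t: "t \<in> EDM_shifts D i j" and c: "sum c UNIV = 0"
  shows "(norm (\<Sum>k\<in>UNIV. c k *\<^sub>R p k))\<^sup>2 \<ge> t * (c i * c j)"
proof -
  obtain q :: "'n \<Rightarrow> real^'n" where q: "generates q (D + t *\<^sub>R E_mat i j)"
    using t by (auto simp: EDM_shifts_def is_EDM_def)
  have "(\<Sum>k\<in>UNIV. \<Sum>l\<in>UNIV. c k * c l * (D + t *\<^sub>R E_mat i j) $ k $ l)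
      = (\<Sum>k\<in>UNIV. \<Sum>l\<in>UNIV. c k * c l * D $ k $ l)
        + t * (\<Sum>k\<in>UNIV. \<Sum>l\<in>UNIV. c k * c l * E_mat i j $ k $ l)"
    by (simp add: sum.distrib sum_distrib_left algebra_simps)
  then have "(norm (\<Sum>k\<in>UNIV. c k *\<^sub>R q k))\<^sup>2 = (norm (\<Sum>k\<in>UNIV. c k *\<^sub>R p k))\<^sup>2 - t * (c i * c j)"
    using generates_norm_comb[OF q c] generates_norm_comb[OF gen c]
    by (simp add: E_mat_quadratic_form[OF \<open>i \<noteq> j\<close>])
  then show ?thesis using zero_le_power2[of "norm (\<Sum>k\<in>UNIV. c k *\<^sub>R q k)"] by linarith
qed

text \<open>Adding a multiple of the dependency \<open>c\<close> to a vector does not change the combination of the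
  points. Since \<open>c i = 0\<close>, it keeps the \<open>i\<close>-th coordinate at \<open>1\<close> while the \<open>j\<close>-th runs through
  all reals, so a fixed quantity bounds every real multiple of \<open>t\<close>.\<close>

lemma shift_eq_0_if_dependency_vanishes_at_one_end:
  fixes p :: "'n::finite \<Rightarrow> 'a::euclidean_space"
  assumes gen: "generates p D" and t: "t \<in> EDM_shifts D i j"
    and c: "sum c UNIV = 0" "(\<Sum>k\<in>UNIV. c k *\<^sub>R p k) = 0" "c i = 0" "c j \<noteq> 0"
  shows "t = 0"
proof (rule ccontr)
  assume "t \<noteq> 0"
  have "i \<noteq> j" using c by auto
  define B where "B = (norm (p i - p j))\<^sup>2"
  \<comment> \<open>This multiple of \<open>c\<close> makes the \<open>j\<close>-th coordinate \<open>(B + 1) / t\<close>.\<close>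
  define s where "s = ((B + 1) / t + 1) / c j"
  define d where "d k = s * c k + ((if k = i then 1 else 0) - (if k = j then 1 else 0))" for k
  have "sum d UNIV = s * sum c UNIV"
    by (simp add: d_def sum.distrib sum_subtractf sum_distrib_left)
  then have "sum d UNIV = 0" using c by simp
  moreover have "(\<Sum>k\<in>UNIV. d k *\<^sub>R p k) = s *\<^sub>R (\<Sum>k\<in>UNIV. c k *\<^sub>R p k) + (p i - p j)"
    by (simp add: d_def scaleR_left_distrib scaleR_left_diff_distrib sum.distrib sum_subtractf
        scaleR_sum_right if_distrib[of "\<lambda>x. x *\<^sub>R _"] cong: if_cong)
  moreover have "t * (d i * d j) = B + 1"
    using c \<open>i \<noteq> j\<close> \<open>t \<noteq> 0\<close> by (simp add: d_def s_def)
  ultimately show False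
    using shift_bound[OF gen \<open>i \<noteq> j\<close> t, of d] c(2) by (simp add: B_def)
qed

section \<open>The characterization of general position\<close>

theorem corollary3p1:
  fixes D :: "real^'n::finite^'n"
  assumes "is_EDM D"
    and "embedding_dim D = int CARD('n) - 2"
  shows "EDM_general_position D \<longleftrightarrow> (\<forall>i j. i \<noteq> j \<longrightarrow> yielding D i j)"
proof -
  obtain p :: "'n \<Rightarrow> real^'n" where p: "generates p D"
    using assms(1) by (auto simp: is_EDM_def)
  have gp_iff: "EDM_general_position D \<longleftrightarrow> points_general_position (int CARD('n) - 2) p"
    using EDM_general_position_iff[OF p] assms(2) by simp
  show ?thesis
  proof (intro iffI allI impI)
    fix i j :: 'n
    assume "EDM_general_position D" and "i \<noteq> j"
    then have gp: "points_general_position (int CARD('n) - 2) p" by (simp add: gp_iff)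
    have "\<not> affinely_independent_family p UNIV"
    proof
      assume "affinely_independent_family p UNIV"
      then have "aff_dim (range p) = int CARD('n) - 1"
        by (simp add: affinely_independent_family_def affine_independent_iff_card card_image)
      then show False using embedding_dim_eq[OF p] assms(2) by simp
    qed
    then obtain c where c: "sum c UNIV = 0" "(\<Sum>k\<in>UNIV. c k *\<^sub>R p k) = 0" "c \<noteq> (\<lambda>_. 0)"
      unfolding affinely_independent_family_iff by auto
    then have "c i \<noteq> 0"
      using gp points_general_position_iff_dependencies_nowhere_zero by blast
    have ind: "affinely_independent_family p (UNIV - {j})"
      using gp by (simp add: points_general_position_def card_Diff_singleton of_nat_diff Suc_leI)
    then have "p ` (UNIV - {j}) - {p i} = p ` (UNIV - {i, j})"
      using \<open>i \<noteq> j\<close> by (auto simp: affinely_independent_family_def inj_on_def)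
    moreover have "p i \<in> p ` (UNIV - {j})" using \<open>i \<noteq> j\<close> by blast
    ultimately have "p i \<notin> affine hull (p ` (UNIV - {i, j}))"
      using ind by (metis affinely_independent_family_def affine_dependent_def)
    then show "yielding D i j"
      using nonzero_shift_by_reflection[OF p \<open>i \<noteq> j\<close> c(1,2) \<open>c i \<noteq> 0\<close>]
      by (simp add: yielding_iff_nonzero_shift[OF assms(1)])
  next
    assume yielding: "\<forall>i j. i \<noteq> j \<longrightarrow> yielding D i j"
    show "EDM_general_position D"
    proof (rule ccontr)
      assume "\<not> EDM_general_position D"
      then obtain c i where c: "sum c UNIV = 0" "(\<Sum>k\<in>UNIV. c k *\<^sub>R p k) = 0"
          "c \<noteq> (\<lambda>_. 0)" "c i = 0"
        unfolding gp_iff points_general_position_iff_dependencies_nowhere_zero by blast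
      then obtain j where "c j \<noteq> 0" by auto
      with c(4) have "i \<noteq> j" by auto
      then obtain t where "t \<in> EDM_shifts D i j" "t \<noteq> 0"
        using yielding yielding_iff_nonzero_shift[OF assms(1)] by blast
      then show False
        using shift_eq_0_if_dependency_vanishes_at_one_end[OF p _ c(1,2,4) \<open>c j \<noteq> 0\<close>] by blast
    qed
  qed
qed

end
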